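(* Let $n\ge 1$, let $T>0$, let $G \in \mathcal{G}^n$ be a graph, let $X \in \mathcal{Q}(G)$, and let $x_0 \in \mathbb{R}^n$. Then the network reconstruction problem is solvable for $(x_0,X,\mathcal{Q})$ if and only if the pair $(x_0^\top,X)$ is observable.
   Context: $\mathbb{S}^n$ is the set of real symmetric $n\times n$ matrices. $\mathcal{G}^n$ is the set of simple undirected graphs (no self-loops, at most one edge between any pair of vertices) with vertex set $V=\{1,\dots,n\}$. For $G\in\mathcal{G}^n$ with edge set $E$, the qualitative class is $\mathcal{Q}(G) := \{X \in \mathbb{S}^n \mid \text{for all } i \neq j,\ X_{ij} \neq 0 \iff (i,j) \in E\}$; this defines a set-valued map $\mathcal{Q}:\mathcal{G}^n\to 2^{\mathbb{S}^n}$. The image of a set-valued map $\mathcal{K} : \mathcal{G}^n \to 2^{\mathbb{S}^n}$ is $\operatorname{im}\mathcal{K} := \{Y \in \mathbb{S}^n \mid \exists\, G\in\mathcal{G}^n \text{ such that } Y \in \mathcal{K}(G)\}$. For matrices $C\in\mathbb{R}^{p\times n}$, $A\in\mathbb{R}^{n\times n}$, the unobservable subspace is $\langle \ker C \mid A\rangle := \bigcap_{i=0}^{n-1} \ker(CA^i)$, and the pair $(C,A)$ is observable if and only if $\langle \ker C \mid A\rangle=\{0\}$. Solvability: for $x_0\in\mathbb{R}^n$ and $X\in\operatorname{im}\mathcal{K}$, let $x_{x_0}(t)=e^{Xt}x_0$ be the solution of $\dot x(t)=Xx(t)$ for $t\ge 0$, $x(0)=x_0$. The network reconstruction problem is said to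 be solvable for $(x_0,X,\mathcal{K})$ if for every $\bar X\in\operatorname{im}\mathcal{K}$ such that $x_{x_0}(\cdot)$ is a solution to $\dot x(t)=\bar X x(t)$ for $t\in[0,T]$, we have $\bar X=X$. Here $T>0$ is a fixed real number. *)

theory Defs
  imports "HOL-Analysis.Analysis" "Graph_Theory.Pair_Digraph"
begin

text \<open>
  The vertex set is the finite index type \<open>'n\<close>, so \<open>CARD('n)\<close> plays the role of the dimension.
  A simple undirected graph is a \<^locale>\<open>pair_graph\<close> (finite, loop-free, symmetric set of
  ordered pairs) whose vertex set is all of \<open>'n\<close>.
\<close>

definition simple_graphs :: "'n::finite pair_pre_digraph set" where
  "simple_graphs = {G. pair_graph G \<and> pverts G = UNIV}"

definition symmetric_matrices :: "(real^'n^'n) set" where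
  "symmetric_matrices = {X. transpose X = X}"

definition qualitative_class :: "'n::finite pair_pre_digraph \<Rightarrow> (real^'n^'n) set" where
  "qualitative_class G =
    {X \<in> symmetric_matrices. \<forall>i j. i \<noteq> j \<longrightarrow> (X $ i $ j \<noteq> 0 \<longleftrightarrow> (i, j) \<in> parcs G)}"

definition graph_map_image ::
  "('n::finite pair_pre_digraph \<Rightarrow> (real^'n^'n) set) \<Rightarrow> (real^'n^'n) set" where
  "graph_map_image K = {Y \<in> symmetric_matrices. \<exists>G\<in>simple_graphs. Y \<in> K G}"

text \<open>
  The operations \<open>*\<close> and \<open>^\<close> on \<open>real^'n^'n\<close> are componentwise, so matrix powers and the
  matrix exponential are built from \<open>**\<close> instead.
\<close>

primrec matrix_power :: "real^'n^'n \<Rightarrow> nat \<Rightarrow> real^'n^'n::finite" where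
  "matrix_power A 0 = mat 1"
| "matrix_power A (Suc k) = A ** matrix_power A k"

definition matrix_exp :: "real^'n^'n \<Rightarrow> real^'n^'n::finite" where
  "matrix_exp A = (\<Sum>k. (1 / fact k) *\<^sub>R matrix_power A k)"

definition unobservable_subspace :: "real^'n^'p \<Rightarrow> real^'n^'n \<Rightarrow> (real^'n::finite) set" where
  "unobservable_subspace C A = (\<Inter>i<CARD('n). {v. (C ** matrix_power A i) *v v = 0})"

definition observable :: "real^'n^'p \<Rightarrow> real^'n^'n::finite \<Rightarrow> bool" where
  "observable C A \<longleftrightarrow> unobservable_subspace C A = {0}"

definition trajectory :: "real^'n \<Rightarrow> real^'n^'n \<Rightarrow> real \<Rightarrow> real^'n::finite" where
  "trajectory x0 X t = matrix_exp (t *\<^sub>R X) *v x0"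

definition solves_linear_ode :: "(real \<Rightarrow> real^'n) \<Rightarrow> real^'n^'n::finite \<Rightarrow> real \<Rightarrow> bool" where
  "solves_linear_ode x A T \<longleftrightarrow>
    (\<forall>t\<in>{0..T}. (x has_vector_derivative A *v x t) (at t within {0..T}))"

definition reconstruction_solvable ::
  "real \<Rightarrow> real^'n \<Rightarrow> real^'n^'n \<Rightarrow> ('n::finite pair_pre_digraph \<Rightarrow> (real^'n^'n) set) \<Rightarrow> bool" where
  "reconstruction_solvable T x0 X K \<longleftrightarrow>
    (\<forall>Y\<in>graph_map_image K. solves_linear_ode (trajectory x0 X) Y T \<longrightarrow> Y = X)"

end

theory Submission
  imports Defs
begin

text \<open>
  Every symmetric matrix lies in some qualitative class, so the competitors of \<open>X\<close> are all symmetric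
  matrices \<open>Y\<close>. Such a \<open>Y\<close> generates the same trajectory iff \<open>D = Y - X\<close> annihilates it on
  \<open>[0, T]\<close>, and differentiating repeatedly at \<open>0\<close> gives \<open>D X\<^sup>k x\<^sub>0 = 0\<close> for all \<open>k\<close>. Since \<open>X\<close> is
  symmetric, this says that the rows of \<open>D\<close> are unobservable for \<open>(x\<^sub>0\<^sup>T, X)\<close>. Conversely, an
  unobservable \<open>v \<noteq> 0\<close> yields the competitor \<open>X + v v\<^sup>T\<close>.
\<close>

section \<open>Krylov subspaces of a linear map\<close>

text \<open>An iterate that depends linearly on its predecessors makes their span invariant under
  \<open>f\<close>, and the dimension forces such an iterate at index at most
  \<open>DIM('a)\<close>. This plays the part of Cayley-Hamilton: finitely many powers control all
  powers.\<close>

lemma linear_funpow_in_span: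
  fixes f :: "'a::euclidean_space \<Rightarrow> 'a"
  assumes "linear f"
  shows "(f ^^ k) x \<in> span ((\<lambda>i. (f ^^ i) x) ` {..<DIM('a)})"
proof -
  define K where "K m = (\<lambda>i. (f ^^ i) x) ` {..<m}" for m
  have K_Suc: "K (Suc m) = insert ((f ^^ m) x) (K m)" for m
    by (auto simp: K_def lessThan_Suc)
  have "\<exists>m\<le>DIM('a). (f ^^ m) x \<in> span (K m)"
  proof (rule ccontr)
    assume "\<not> ?thesis"
    then have new: "(f ^^ m) x \<notin> span (K m)" if "m \<le> DIM('a)" for m
      using that by blast
    \<comment> \<open>The cardinality is carried along because \<open>K m\<close> is an image, in
      which equal iterates would collapse. At \<open>m = Suc DIM('a)\<close> there are too many
      independent vectors.\<close>
    have "independent (K m) \<and> card (K m) = m" if "m \<le> Suc DIM('a)" for m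
      using that
    proof (induction m)
      case 0
      show ?case by (simp add: K_def independent_empty)
    next
      case (Suc m)
      then have IH: "independent (K m)" "card (K m) = m" and "(f ^^ m) x \<notin> span (K m)"
        using new by auto
      moreover from this have "(f ^^ m) x \<notin> K m"
        using span_base by blast
      moreover have "finite (K m)"
        by (simp add: K_def)
      ultimately show ?case
        by (simp add: K_Suc independent_insertI)
    qed
    from this[of "Suc DIM('a)"] show False
      using independent_bound[of "K (Suc DIM('a))"] by auto
  qed
  then obtain m where m: "m \<le> DIM('a)" "(f ^^ m) x \<in> span (K m)"
    by blast
  have "f ` K m \<subseteq> span (K m)"
  proof
    fix y assume "y \<in> f ` K m"
    then obtain i where i: "i < m" "y = (f ^^ Suc i) x"
      by (auto simp: K_def)
    \<comment> \<open>Applying \<open>f\<close> shifts the generators by one, so only the last one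
      can leave \<open>K m\<close>; its image is the dependent iterate.\<close>
    show "y \<in> span (K m)"
    proof (cases "Suc i = m")
      case False
      with i have "y \<in> K m"
        unfolding K_def by (intro image_eqI[of _ _ "Suc i"]) auto
      then show ?thesis by (rule span_base)
    qed (use i m in auto)
  qed
  then have "span (f ` K m) \<subseteq> span (K m)"
    by (simp add: span_minimal)
  then have invariant: "f y \<in> span (K m)" if "y \<in> span (K m)" for y
    using that linear_span_image[OF assms, of "K m"] by blast
  have "(f ^^ k) x \<in> span (K m)"
  proof (induction k)
    case 0
    show ?case
    proof (cases m)
      case 0
      \<comment> \<open>Here \<open>x\<close> is not among the generators, but the choice of
        \<open>m\<close> itself puts it into the span of the empty set.\<close>
      then show ?thesis using m by simp
    next
      case (Suc l)
      then have "x \<in> K m"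
        unfolding K_def by (intro image_eqI[of _ _ 0]) auto
      then show ?thesis by (simp add: span_base)
    qed
  qed (simp add: invariant)
  moreover have "span (K m) \<subseteq> span (K DIM('a))"
    using m by (intro span_mono) (auto simp: K_def)
  ultimately show ?thesis
    by (auto simp: K_def)
qed

section \<open>Matrix powers and convergence of the exponential series\<close>

lemma matrix_power_mult_vec: "matrix_power A k *v x = ((*v) A ^^ k) x"
  by (induction k) (simp_all flip: matrix_vector_mul_assoc)

lemma scaleR_matrix_mult: "(c *\<^sub>R A) ** B = c *\<^sub>R (A ** B)" for A :: "real^'n^'m"
  by (simp add: matrix_matrix_mult_def vec_eq_iff sum_distrib_left mult_ac)

lemma matrix_mult_scaleR: "A ** (c *\<^sub>R B) = c *\<^sub>R (A ** B)" for A :: "real^'n^'m"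
  by (simp add: matrix_matrix_mult_def vec_eq_iff sum_distrib_left mult_ac)

lemma matrix_power_scaleR: "matrix_power (c *\<^sub>R A) k = c ^ k *\<^sub>R matrix_power A k"
  by (induction k) (simp_all add: scaleR_matrix_mult matrix_mult_scaleR)

lemma bounded_bilinear_matrix_mult:
  "bounded_bilinear ((**) :: real^'n^'m \<Rightarrow> real^'p^'n \<Rightarrow> real^'p^'m)"
  unfolding bilinear_conv_bounded_bilinear[symmetric] bilinear_def
  by (intro conjI allI linearI)
     (simp_all add: matrix_matrix_mult_def vec_eq_iff sum.distrib distrib_left distrib_right
       sum_distrib_left mult.left_commute mult.assoc)

lemma matrix_exp_sums:
  fixes A :: "real^'n^'n::finite"
  shows "(\<lambda>k. (1 / fact k) *\<^sub>R matrix_power A k) sums matrix_exp A"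
proof -
  \<comment> \<open>Boundedness of the bilinear product replaces submultiplicativity of the norm;
    the constant \<open>c\<close> is absorbed into \<open>r\<close>. Likewise
    \<open>norm (mat 1)\<close> need not be 1 and stays as a factor.\<close>
  obtain c where c: "c > 0" and mult: "\<And>(M :: real^'n^'n) (N :: real^'n^'n). norm (M ** N) \<le> norm M * norm N * c"
    using bounded_bilinear.pos_bounded[OF bounded_bilinear_matrix_mult] by blast
  define r where "r = norm A * c"
  have power: "norm (matrix_power A k) \<le> r ^ k * norm (mat 1 :: real^'n^'n)" for k
  proof (induction k)
    case (Suc k)
    have "norm (matrix_power A (Suc k)) \<le> r * norm (matrix_power A k)"
      using mult[of A "matrix_power A k"] by (simp add: r_def mult_ac)
    also have "\<dots> \<le> r * (r ^ k * norm (mat 1 :: real^'n^'n))"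
      using c Suc by (intro mult_left_mono) (auto simp: r_def)
    finally show ?case by (simp add: mult_ac)
  qed simp
  have "summable (\<lambda>k. inverse (fact k) * r ^ k * norm (mat 1 :: real^'n^'n))"
    by (intro summable_mult2 summable_exp)
  moreover have "norm ((1 / fact k) *\<^sub>R matrix_power A k)
      \<le> inverse (fact k) * r ^ k * norm (mat 1 :: real^'n^'n)" for k
    using mult_left_mono[OF power[of k], of "inverse (fact k)"] by (simp add: divide_simps mult_ac)
  ultimately have "summable (\<lambda>k. (1 / fact k) *\<^sub>R matrix_power A k)"
    by (rule summable_comparison_test'[where N = 0])
  then show ?thesis
    unfolding matrix_exp_def by (rule summable_sums)
qed

section \<open>The trajectory as a power series and its derivatives\<close>

lemma trajectory_sums:
  fixes X :: "real^'n^'n::finite"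
  shows "(\<lambda>k. (t ^ k / fact k) *\<^sub>R ((*v) X ^^ k) x0) sums trajectory x0 X t"
proof -
  have "linear (\<lambda>M :: real^'n^'n. M *v x0)"
    by (intro linearI) (simp_all add: matrix_vector_mult_add_rdistrib scaleR_matrix_vector_assoc)
  then have "bounded_linear (\<lambda>M :: real^'n^'n. M *v x0)"
    by (simp add: linear_conv_bounded_linear)
  from bounded_linear.sums[OF this matrix_exp_sums[of "t *\<^sub>R X"]]
  show ?thesis
    by (simp add: trajectory_def matrix_power_scaleR matrix_power_mult_vec
        flip: scaleR_matrix_vector_assoc)
qed

lemma trajectory_0: "trajectory x0 X 0 = x0"
proof -
  have "(\<lambda>k. (0 ^ k / fact k) *\<^sub>R ((*v) X ^^ k) x0) = (\<lambda>k. if k = 0 then x0 else 0)"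
    by auto
  then show ?thesis
    using trajectory_sums[of 0 X x0] sums_unique2[OF _ sums_single[of 0 "\<lambda>_. x0"]] by simp
qed

text \<open>Pairing with a fixed vector \<open>a\<close> reduces the claim to termwise
  differentiation of a real power series that converges everywhere.\<close>

lemma trajectory_has_vector_derivative:
  "(trajectory x0 X has_vector_derivative X *v trajectory x0 X t) (at t within S)"
proof -
  have "((\<lambda>s. trajectory x0 X s \<bullet> a) has_field_derivative (X *v trajectory x0 X t) \<bullet> a) (at t)" for a
  proof -
    define c where "c k = (((*v) X ^^ k) x0 \<bullet> a) / fact k" for k
    have sums: "(\<lambda>k. c k * s ^ k) sums (trajectory x0 X s \<bullet> a)" for s
      using bounded_linear.sums[OF bounded_linear_inner_left[of a] trajectory_sums[of s X x0]]
      by (simp add: c_def mult_ac)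
    \<comment> \<open>The factor \<open>Suc k\<close> from differentiation cancels in
      \<open>fact (Suc k)\<close>, and the shifted index leaves one extra \<open>X\<close> in
      front.\<close>
    have "diffs c k * t ^ k = (X *v ((t ^ k / fact k) *\<^sub>R ((*v) X ^^ k) x0)) \<bullet> a" for k
      by (simp add: c_def diffs_def matrix_vector_mult_scaleR del: of_nat_Suc)
    then have "(\<lambda>k. diffs c k * t ^ k) sums ((X *v trajectory x0 X t) \<bullet> a)"
      using bounded_linear.sums[OF bounded_linear_inner_left[of a]
          bounded_linear.sums[OF matrix_vector_mul_bounded_linear trajectory_sums[of t X x0]], of X]
      by simp
    then show ?thesis
      using termdiffs_strong_converges_everywhere[of c t] sums by (simp add: sums_iff)
  qed
  then have "(trajectory x0 X has_vector_derivative X *v trajectory x0 X t) (at t)"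
    unfolding has_vector_derivative_def has_field_derivative_def
    by (subst has_derivative_componentwise_within) (auto simp: mult_commute_abs)
  then show ?thesis
    by (rule has_vector_derivative_at_within)
qed

text \<open>The trajectory already has derivative \<open>X *v trajectory x0 X t\<close>, and
  derivatives within a nondegenerate closed interval are unique, endpoints included.\<close>

lemma solves_linear_ode_trajectory_iff:
  assumes "T > 0"
  shows "solves_linear_ode (trajectory x0 X) Y T \<longleftrightarrow>
    (\<forall>t\<in>{0..T}. Y *v trajectory x0 X t = X *v trajectory x0 X t)"
proof -
  have "(trajectory x0 X has_vector_derivative Y *v trajectory x0 X t) (at t within {0..T}) \<longleftrightarrow>
      Y *v trajectory x0 X t = X *v trajectory x0 X t" if "t \<in> {0..T}" for t
    using vector_derivative_unique_within_closed_interval[of 0 T t "trajectory x0 X"] assms that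
      trajectory_has_vector_derivative[of x0 X t "{0..T}"] by auto
  then show ?thesis
    by (simp add: solves_linear_ode_def)
qed

text \<open>Each induction step differentiates the identity once. It is stated on all of
  \<open>[0, T]\<close>, since its value at a single time could not be differentiated.\<close>

lemma annihilates_trajectory_funpow:
  assumes "T > 0" and "\<forall>t\<in>{0..T}. D *v trajectory x0 X t = 0"
  shows "t \<in> {0..T} \<Longrightarrow> D *v (((*v) X ^^ k) (trajectory x0 X t)) = 0"
proof (induction k arbitrary: t)
  case (Suc k)
  let ?g = "\<lambda>s. D *v (((*v) X ^^ k) (trajectory x0 X s))"
  have "bounded_linear (\<lambda>y. (D ** matrix_power X k) *v y)"
    by simp
  from bounded_linear.has_vector_derivative[OF this
      trajectory_has_vector_derivative[of x0 X t "{0..T}"]]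
  have "(?g has_vector_derivative D *v (((*v) X ^^ k) (X *v trajectory x0 X t))) (at t within {0..T})"
    by (simp add: matrix_power_mult_vec flip: matrix_vector_mul_assoc)
  moreover have "(?g has_vector_derivative 0) (at t within {0..T})"
    using Suc by (intro has_vector_derivative_transform[OF _ _ has_vector_derivative_const]) auto
  ultimately show ?case
    using vector_derivative_unique_within_closed_interval[of 0 T t ?g] assms Suc.prems
    by (simp add: funpow_swap1)
qed (use assms in auto)

section \<open>Observability for symmetric matrices\<close>

lemma symmetric_matrices_inner:
  assumes "X \<in> symmetric_matrices"
  shows "(X *v a) \<bullet> b = a \<bullet> (X *v b)"
  using assms dot_lmul_matrix[of a X b] vector_transpose_matrix[of a X]
  by (simp add: symmetric_matrices_def)

lemma symmetric_matrices_funpow_inner: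
  assumes "X \<in> symmetric_matrices"
  shows "((*v) X ^^ k) a \<bullet> b = a \<bullet> ((*v) X ^^ k) b"
  by (induction k arbitrary: b)
     (simp_all add: symmetric_matrices_inner[OF assms] flip: funpow_swap1)

text \<open>Symmetry moves the powers of \<open>X\<close> from \<open>v\<close> onto
  \<open>x0\<close>, so unobservable means orthogonal to the Krylov vectors of \<open>x0\<close>;
  those of index below \<open>CARD('n)\<close> span all the others.\<close>

lemma unobservable_rowvector_iff:
  fixes v x0 :: "real^'n::finite"
  assumes "X \<in> symmetric_matrices"
  shows "v \<in> unobservable_subspace (rowvector x0 :: real^'n^1) X \<longleftrightarrow>
    (\<forall>k. v \<bullet> ((*v) X ^^ k) x0 = 0)"
proof -
  have row: "(rowvector x0 :: real^'n^1) *v w = 0 \<longleftrightarrow> x0 \<bullet> w = 0" for w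
    by (simp add: vec_eq_iff matrix_vector_mult_def rowvector_def inner_vec_def)
  have "x0 \<bullet> ((*v) X ^^ k) v = v \<bullet> ((*v) X ^^ k) x0" for k
    by (metis assms symmetric_matrices_funpow_inner inner_commute)
  then have "v \<in> unobservable_subspace (rowvector x0 :: real^'n^1) X \<longleftrightarrow>
      (\<forall>k<CARD('n). v \<bullet> ((*v) X ^^ k) x0 = 0)"
    by (auto simp: unobservable_subspace_def row matrix_power_mult_vec
        simp flip: matrix_vector_mul_assoc)
  also have "\<dots> \<longleftrightarrow> (\<forall>k. v \<bullet> ((*v) X ^^ k) x0 = 0)"
  proof safe
    fix k
    assume "\<forall>k<CARD('n). v \<bullet> ((*v) X ^^ k) x0 = 0"
    then have "(\<lambda>i. ((*v) X ^^ i) x0) ` {..<DIM(real^'n)} \<subseteq> {w. v \<bullet> w = 0}"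
      by auto
    then have "span ((\<lambda>i. ((*v) X ^^ i) x0) ` {..<DIM(real^'n)}) \<subseteq> {w. v \<bullet> w = 0}"
      by (intro span_minimal subspace_hyperplane)
    then show "v \<bullet> ((*v) X ^^ k) x0 = 0"
      using linear_funpow_in_span[of "(*v) X" k x0] by auto
  qed auto
  finally show ?thesis .
qed

lemma graph_map_image_qualitative_class:
  "graph_map_image qualitative_class = (symmetric_matrices :: (real^'n^'n::finite) set)"
proof -
  have "\<exists>G\<in>simple_graphs. Y \<in> qualitative_class G" if Y: "Y \<in> symmetric_matrices" for Y :: "real^'n^'n"
  proof
    \<comment> \<open>The graph is the off-diagonal support of \<open>Y\<close>; leaving out the
      diagonal excludes loops.\<close>
    let ?G = "\<lparr>pverts = UNIV, parcs = {(i, j). i \<noteq> j \<and> Y $ i $ j \<noteq> 0}\<rparr>"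
    have "Y $ i $ j = Y $ j $ i" for i j
      using Y by (simp add: symmetric_matrices_def transpose_def vec_eq_iff)
    then have "sym (parcs ?G)"
      by (auto simp: sym_def)
    then show "?G \<in> simple_graphs"
      unfolding simple_graphs_def by simp (unfold_locales, auto simp: symmetric_def arcs_ends_def arc_to_ends_def)
    show "Y \<in> qualitative_class ?G"
      using Y by (simp add: qualitative_class_def)
  qed
  then show ?thesis
    by (auto simp: graph_map_image_def)
qed

theorem theorem6:
  fixes T :: real
    and G :: "'n::finite pair_pre_digraph"
    and X :: "real^'n^'n"
    and x0 :: "real^'n"
  assumes "T > 0"
    and "G \<in> simple_graphs"
    and "X \<in> qualitative_class G"
  shows "reconstruction_solvable T x0 X qualitative_class \<longleftrightarrow>
    observable (rowvector x0 :: real^'n^1) X"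
proof
  have X: "X \<in> symmetric_matrices"
    using assms by (simp add: qualitative_class_def)
  let ?U = "unobservable_subspace (rowvector x0 :: real^'n^1) X"
  show "observable (rowvector x0 :: real^'n^1) X"
    if solvable: "reconstruction_solvable T x0 X qualitative_class"
  proof -
    have "v = 0" if "v \<in> ?U" for v
    proof -
      \<comment> \<open>The rank-one matrix \<open>v v^T\<close> is symmetric and kills exactly the
        vectors orthogonal to \<open>v\<close>.\<close>
      define P where "P = (columnvector v :: real^1^'n) ** (rowvector v :: real^'n^1)"
      have P: "P $ i $ j = v $ i * v $ j" for i j
        by (simp add: P_def columnvector_def rowvector_def matrix_matrix_mult_def)
      have P_mult: "P *v w = (v \<bullet> w) *\<^sub>R v" for w
        by (simp add: vec_eq_iff matrix_vector_mult_def P inner_vec_def sum_distrib_left mult_ac)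
      \<comment> \<open>Every term of the exponential series applied to \<open>x0\<close> is
        orthogonal to \<open>v\<close>.\<close>
      have "v \<bullet> trajectory x0 X t = 0" for t
        using bounded_linear.sums[OF bounded_linear_inner_right[of v] trajectory_sums[of t X x0]]
          that unobservable_rowvector_iff[OF X] sums_unique2[OF _ sums_zero] by simp
      then have "solves_linear_ode (trajectory x0 X) (X + P) T"
        using assms(1)
        by (simp add: solves_linear_ode_trajectory_iff matrix_vector_mult_add_rdistrib P_mult)
      moreover have "X + P \<in> symmetric_matrices"
        using X by (simp add: symmetric_matrices_def transpose_def vec_eq_iff P mult.commute)
      ultimately have "X + P = X"
        using solvable
        by (auto simp: reconstruction_solvable_def graph_map_image_qualitative_class)
      \<comment> \<open>Evaluating at \<open>v\<close> itself gives
        \<open>(v \<bullet> v) *\<^sub>R v\<close>, which vanishes only for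
        \<open>v = 0\<close>.\<close>
      then have "P *v v = 0"
        by simp
      then show "v = 0"
        by (simp add: P_mult)
    qed
    moreover have "0 \<in> ?U"
      by (simp add: unobservable_subspace_def)
    ultimately show ?thesis
      by (auto simp: observable_def)
  qed
  show "reconstruction_solvable T x0 X qualitative_class"
    if obs: "observable (rowvector x0 :: real^'n^1) X"
    unfolding reconstruction_solvable_def graph_map_image_qualitative_class
  proof safe
    fix Y :: "real^'n^'n"
    assume "solves_linear_ode (trajectory x0 X) Y T"
    then have "\<forall>t\<in>{0..T}. (Y - X) *v trajectory x0 X t = 0"
      using assms(1)
      by (simp add: solves_linear_ode_trajectory_iff matrix_vector_mult_diff_rdistrib)
    then have D: "(Y - X) *v (((*v) X ^^ k) x0) = 0" for k
      using annihilates_trajectory_funpow[of T "Y - X" x0 X 0 k] assms(1)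
      by (simp add: trajectory_0)
    \<comment> \<open>The inner product of row \<open>i\<close> of \<open>Y - X\<close> with a
      Krylov vector is the \<open>i\<close>-th entry of the product in \<open>D\<close>.\<close>
    have "(Y - X) $ i \<in> ?U" for i
      unfolding unobservable_rowvector_iff[OF X]
      by (metis D matrix_vector_mul_component zero_index)
    then have "(Y - X) $ i = 0" for i
      using obs by (auto simp: observable_def)
    then show "Y = X"
      by (simp add: vec_eq_iff)
  qed
qed

end
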